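(* Let $A$ be a finite set, $(M,d)$ a nonempty complete metric space and $\sigma:A\to\operatorname{Con}(M,d)$ a contraction operator interpretation. For a subset $K\subseteq M$ of the self-similar set $\mathbf S_\sigma$, the following are equivalent: (i) $K$ is a regular subfractal, i.e. $K=[\![e]\!]_\sigma$ for some process term $e$; (ii) there exist a finite productive LTS $(X,\alpha)$ with labels in $A$ and a state $x\in X$ such that $K=\varphi(x)$, where $\varphi$ is the ($\sigma$-)solution to $(X,\alpha)$.
   Context: An LTS is $(X,\alpha)$ with $\alpha:X\to\mathcal P(A\times X)$; write $x\xrightarrow{a}y$ if $(a,y)\in\alpha(x)$; productive means $\alpha(x)\ne\emptyset$ for all $x$. A state $x$ emits a stream $(a_1,a_2,\dots)\in A^\omega$ if for every $n$ there is a path $x\xrightarrow{a_1}x_1\cdots\xrightarrow{a_n}x_n$. $\operatorname{Con}(M,d)$: maps $h:M\to M$ with $d(h(p),h(q))\le r\,d(p,q)$ for some $r<1$. $\sigma_\omega(a_1,\dots)=\lim_n\sigma_{a_1}\cdots\sigma_{a_n}(p)$ ($p\in M$ arbitrary); $\mathbf S_\sigma=\{\sigma_\omega(s): s\in A^\omega\}$; $[\![x]\!]_{\alpha,\sigma}=\{\sigma_\omega(s): s\text{ emitted by }x\}$. A $\sigma$-solution to $(X,\alpha)$ is $\varphi:X\to\mathbf K(M,d)$ (nonempty compact subsets) with $\varphi(x)=\bigcup_{x\xrightarrow{a}y}\sigma_a(\varphi(y))$ for all $x$; a finite productive LTS has exactly one. Process terms: fix countably many variables $v_1,v_2,\dots$;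 terms are generated by $e::= v\mid ae\mid e_1+e_2\mid \mu v\,e$ ($a\in A$). A process term is a term that is closed (every occurrence of a variable $v$ lies in the scope of a binder $\mu v$) and guarded (every such occurrence lies, inside its binder, in the scope of some prefix $a(-)$). $\mathsf{Term}$, the set of process terms, is an LTS $\gamma$ whose transitions are the least relation satisfying: $ae\xrightarrow{a}e$; if $e_1\xrightarrow{a}f$ then $e_1+e_2\xrightarrow{a}f$; if $e_2\xrightarrow{a}f$ then $e_1+e_2\xrightarrow{a}f$; if $e[\mu v\,e/v]\xrightarrow{a}f$ then $\mu v\,e\xrightarrow{a}f$ (where $e[g/v]$ is capture-avoiding substitution of $g$ for free occurrences of $v$). For $e\in\mathsf{Term}$, $[\![e]\!]_\sigma=[\![e]\!]_{\gamma,\sigma}$. *)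

theory Defs
  imports "HOL-Analysis.Analysis"
begin

section \<open>Labelled transition systems\<close>

definition lts :: "'a set \<Rightarrow> 'x set \<Rightarrow> ('x \<Rightarrow> ('a \<times> 'x) set) \<Rightarrow> bool" where
  "lts A X \<alpha> \<longleftrightarrow> (\<forall>x\<in>X. \<alpha> x \<subseteq> A \<times> X)"

definition productive :: "'x set \<Rightarrow> ('x \<Rightarrow> ('a \<times> 'x) set) \<Rightarrow> bool" where
  "productive X \<alpha> \<longleftrightarrow> (\<forall>x\<in>X. \<alpha> x \<noteq> {})"

text \<open>Streams are functions on \<open>nat\<close>, so \<open>s i\<close> is the letter at position \<open>i + 1\<close>. The path
  may depend on \<open>n\<close>.\<close>

definition emits :: "('x \<Rightarrow> ('a \<times> 'x) set) \<Rightarrow> 'x \<Rightarrow> (nat \<Rightarrow> 'a) \<Rightarrow> bool" where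
  "emits \<alpha> x s \<longleftrightarrow>
    (\<forall>n. \<exists>p. p 0 = x \<and> (\<forall>i<n. (s i, p (Suc i)) \<in> \<alpha> (p i)))"

section \<open>Contraction operator interpretations\<close>

definition Con :: "('m::metric_space \<Rightarrow> 'm) set" where
  "Con = {h. \<exists>r<1. \<forall>p q. dist (h p) (h q) \<le> r * dist p q}"

primrec prefix_map :: "('a \<Rightarrow> 'm \<Rightarrow> 'm) \<Rightarrow> (nat \<Rightarrow> 'a) \<Rightarrow> nat \<Rightarrow> 'm \<Rightarrow> 'm" where
  "prefix_map \<sigma> s 0 = id"
| "prefix_map \<sigma> s (Suc n) = prefix_map \<sigma> s n \<circ> \<sigma> (s n)"

definition sigma_omega ::
    "('a \<Rightarrow> 'm::complete_space \<Rightarrow> 'm) \<Rightarrow> (nat \<Rightarrow> 'a) \<Rightarrow> 'm" where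
  "sigma_omega \<sigma> s = (THE q. \<forall>p. (\<lambda>n. prefix_map \<sigma> s n p) \<longlonglongrightarrow> q)"

definition self_similar_set ::
    "'a set \<Rightarrow> ('a \<Rightarrow> 'm::complete_space \<Rightarrow> 'm) \<Rightarrow> 'm set" where
  "self_similar_set A \<sigma> = {sigma_omega \<sigma> s | s. range s \<subseteq> A}"

definition state_sem ::
    "('x \<Rightarrow> ('a \<times> 'x) set) \<Rightarrow> ('a \<Rightarrow> 'm::complete_space \<Rightarrow> 'm) \<Rightarrow> 'x \<Rightarrow> 'm set" where
  "state_sem \<alpha> \<sigma> x = {sigma_omega \<sigma> s | s. emits \<alpha> x s}"

text \<open>A solution is a map on \<open>X\<close>; its values outside \<open>X\<close> are irrelevant, so uniqueness of
  solutions is to be read on \<open>X\<close>.\<close>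

definition solution ::
    "('a \<Rightarrow> 'm::complete_space \<Rightarrow> 'm) \<Rightarrow> 'x set \<Rightarrow> ('x \<Rightarrow> ('a \<times> 'x) set) \<Rightarrow> ('x \<Rightarrow> 'm set) \<Rightarrow> bool"
  where
  "solution \<sigma> X \<alpha> \<phi> \<longleftrightarrow>
    (\<forall>x\<in>X. \<phi> x \<noteq> {} \<and> compact (\<phi> x) \<and> \<phi> x = (\<Union>(a, y)\<in>\<alpha> x. \<sigma> a ` \<phi> y))"

section \<open>Process terms\<close>

datatype (labels: 'a) pterm =
    Var nat
  | Prefix 'a "'a pterm"
  | Plus "'a pterm" "'a pterm"
  | Mu nat "'a pterm"

primrec fv :: "'a pterm \<Rightarrow> nat set" where
  "fv (Var v) = {v}"
| "fv (Prefix a e) = fv e"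
| "fv (Plus e1 e2) = fv e1 \<union> fv e2"
| "fv (Mu v e) = fv e - {v}"

text \<open>Variables with a free occurrence that is not in the scope of any prefix.\<close>

primrec unguarded_fv :: "'a pterm \<Rightarrow> nat set" where
  "unguarded_fv (Var v) = {v}"
| "unguarded_fv (Prefix a e) = {}"
| "unguarded_fv (Plus e1 e2) = unguarded_fv e1 \<union> unguarded_fv e2"
| "unguarded_fv (Mu v e) = unguarded_fv e - {v}"

text \<open>Every bound occurrence has a prefix between it and the binder that binds it
  (the innermost enclosing \<open>Mu\<close> for that variable).\<close>

primrec guarded :: "'a pterm \<Rightarrow> bool" where
  "guarded (Var v) \<longleftrightarrow> True"
| "guarded (Prefix a e) \<longleftrightarrow> guarded e"
| "guarded (Plus e1 e2) \<longleftrightarrow> guarded e1 \<and> guarded e2"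
| "guarded (Mu v e) \<longleftrightarrow> v \<notin> unguarded_fv e \<and> guarded e"

definition process_terms :: "'a set \<Rightarrow> 'a pterm set" where
  "process_terms A = {e. labels e \<subseteq> A \<and> fv e = {} \<and> guarded e}"

text \<open>Capture-avoiding simultaneous substitution. A binder is renamed exactly when it would
  capture a variable of a substituted term; being simultaneous makes the recursion structural
  in spite of the renaming.\<close>

definition binder_name :: "nat set \<Rightarrow> nat \<Rightarrow> nat" where
  "binder_name C w = (if w \<in> C then (LEAST u. u \<notin> C) else w)"

primrec msubst :: "'a pterm \<Rightarrow> (nat \<Rightarrow> 'a pterm) \<Rightarrow> 'a pterm" where
  "msubst (Var v) \<rho> = \<rho> v"
| "msubst (Prefix a e) \<rho> = Prefix a (msubst e \<rho>)"
| "msubst (Plus e1 e2) \<rho> = Plus (msubst e1 \<rho>) (msubst e2 \<rho>)"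
| "msubst (Mu w e) \<rho> =
    (let w' = binder_name (\<Union>u\<in>fv e - {w}. fv (\<rho> u)) w
     in Mu w' (msubst e (\<rho>(w := Var w'))))"

definition subst :: "'a pterm \<Rightarrow> 'a pterm \<Rightarrow> nat \<Rightarrow> 'a pterm" where
  "subst e g v = msubst e (Var(v := g))"

text \<open>The relation is generated on all terms. Derivations of transitions of a process term
  only involve transitions of process terms, so on \<open>process_terms A\<close> this is the least relation
  closed under the same rules there.\<close>

inductive step :: "'a pterm \<Rightarrow> 'a \<Rightarrow> 'a pterm \<Rightarrow> bool" where
  prefix: "step (Prefix a e) a e"
| plus_left: "step e1 a f \<Longrightarrow> step (Plus e1 e2) a f"
| plus_right: "step e2 a f \<Longrightarrow> step (Plus e1 e2) a f"
| mu: "step (subst e (Mu v e) v) a f \<Longrightarrow> step (Mu v e) a f"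

definition term_lts :: "'a pterm \<Rightarrow> ('a \<times> 'a pterm) set" where
  "term_lts e = {(a, f). step e a f}"

definition regular_subfractal ::
    "'a set \<Rightarrow> ('a \<Rightarrow> 'm::complete_space \<Rightarrow> 'm) \<Rightarrow> 'm set \<Rightarrow> bool" where
  "regular_subfractal A \<sigma> K \<longleftrightarrow> (\<exists>e\<in>process_terms A. K = state_sem term_lts \<sigma> e)"

end

theory Submission
  imports Defs
begin

text \<open>In a finite system the value of any solution at a state is the set of limits of the streams
  emitted there: unfolding the fixed-point equations \<open>n\<close> times determines a point up to
  \<open>r ^ n\<close>. The closures of these limit sets form a solution, so every finite productive system has
  one. It remains to see that process terms and states of finite productive systems emit the
  same streams. A closed guarded term has only finitely many derivatives. Conversely, the system
  is read as a system of equations with one binder per state, and the resulting closed terms are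
  bisimilar to the states.\<close>

section \<open>Emitted streams\<close>

text \<open>It is not evident that \<open>state_sem \<alpha> \<sigma> x\<close> is closed, while
  solutions must have compact values. Closedness is never proved directly: it follows once the
  description of arbitrary solutions is applied to the solution made of closures. On the syntactic
  side, unfolding \<open>Mu v e\<close> yields a term that need not be smaller, so structural
  induction on terms alone fails. Statements are therefore proved for \<open>msubst e \<rho>\<close>
  by induction on \<open>e\<close>, with \<rho> holding the unfolded binders. Conversely, one state
  reached below different binders gets different terms, which is why states and terms are linked by
  a relation and not by a function.\<close>

lemma emits_simulation:
  assumes sim: "\<And>x t a y. R x t \<Longrightarrow> (a, y) \<in> \<alpha> x \<Longrightarrow> \<exists>f. (a, f) \<in> \<beta> t \<and> R y f"
    and "R x t" and "emits \<alpha> x s"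
  shows "emits \<beta> t s"
  unfolding emits_def
proof
  fix n
  obtain p where p: "p 0 = x" "\<And>i. i < n \<Longrightarrow> (s i, p (Suc i)) \<in> \<alpha> (p i)"
    using \<open>emits \<alpha> x s\<close> unfolding emits_def by blast
  have "\<exists>q. q 0 = t \<and> (\<forall>i<m. (s i, q (Suc i)) \<in> \<beta> (q i)) \<and> R (p m) (q m)" if "m \<le> n" for m
    using that
  proof (induction m)
    case 0
    then show ?case using p \<open>R x t\<close> by auto
  next
    case (Suc m)
    then obtain q where q: "q 0 = t" "\<forall>i<m. (s i, q (Suc i)) \<in> \<beta> (q i)" "R (p m) (q m)"
      by auto
    obtain f where f: "(s m, f) \<in> \<beta> (q m)" "R (p (Suc m)) f"
      using sim[OF q(3)] p(2) Suc.prems by (metis Suc_le_eq)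
    show ?case
      by (rule exI[of _ "q(Suc m := f)"]) (use q f in \<open>auto simp: less_Suc_eq\<close>)
  qed
  then show "\<exists>q. q 0 = t \<and> (\<forall>i<n. (s i, q (Suc i)) \<in> \<beta> (q i))"
    by blast
qed

lemma emits_bisimulation:
  assumes "\<And>x t a y. R x t \<Longrightarrow> (a, y) \<in> \<alpha> x \<Longrightarrow> \<exists>f. (a, f) \<in> \<beta> t \<and> R y f"
    and "\<And>x t a f. R x t \<Longrightarrow> (a, f) \<in> \<beta> t \<Longrightarrow> \<exists>y. (a, y) \<in> \<alpha> x \<and> R y f"
    and "R x t"
  shows "emits \<alpha> x s \<longleftrightarrow> emits \<beta> t s"
  using emits_simulation[where R = R and \<alpha> = \<alpha> and \<beta> = \<beta>]
    emits_simulation[where R = "\<lambda>t x. R x t" and \<alpha> = \<beta> and \<beta> = \<alpha>] assms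
  by (smt (verit, best))

lemma path_in_carrier:
  assumes "lts A X \<alpha>" "p 0 \<in> X" "\<And>i. i < n \<Longrightarrow> (s i, p (Suc i)) \<in> \<alpha> (p i)" "m \<le> n"
  shows "p m \<in> X"
  using assms(4)
proof (induction m)
  case (Suc m)
  then have "p m \<in> X" "(s m, p (Suc m)) \<in> \<alpha> (p m)" using assms(3) by auto
  then show ?case using assms(1) unfolding lts_def by blast
qed (use assms in simp)

lemma emits_labels:
  assumes "lts A X \<alpha>" "x \<in> X" "emits \<alpha> x s"
  shows "range s \<subseteq> A"
proof
  fix a assume "a \<in> range s"
  then obtain i where a: "a = s i" by blast
  obtain p where p: "p 0 = x" "\<And>j. j < Suc i \<Longrightarrow> (s j, p (Suc j)) \<in> \<alpha> (p j)"
    using assms(3) unfolding emits_def by meson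
  have "p i \<in> X"
    using path_in_carrier[OF assms(1), of p "Suc i" s i] p assms(2) by auto
  then show "a \<in> A" using p(2)[of i] assms(1) a unfolding lts_def by blast
qed

lemma emits_Cons:
  assumes "(a, y) \<in> \<alpha> x" "emits \<alpha> y s"
  shows "emits \<alpha> x (case_nat a s)"
  unfolding emits_def
proof
  fix n
  obtain p where "p 0 = y" "\<forall>i<n. (s i, p (Suc i)) \<in> \<alpha> (p i)"
    using assms(2) unfolding emits_def by blast
  then show "\<exists>p. p 0 = x \<and> (\<forall>i<n. (case_nat a s i, p (Suc i)) \<in> \<alpha> (p i))"
    using assms(1) by (intro exI[of _ "case_nat x p"]) (auto split: nat.splits)
qed

text \<open>A Koenig argument. For each \<open>n\<close> some successor follows the tail for
  \<open>n\<close> steps; with finitely many successors one of them serves infinitely many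
  \<open>n\<close>, hence all \<open>n\<close>, since longer paths restrict to shorter ones.\<close>

lemma emits_tail:
  assumes "finite (\<alpha> x)" "emits \<alpha> x s"
  shows "\<exists>y. (s 0, y) \<in> \<alpha> x \<and> emits \<alpha> y (s \<circ> Suc)"
proof -
  let ?Q = "\<lambda>n y p. p 0 = y \<and> (\<forall>i<n. ((s \<circ> Suc) i, p (Suc i)) \<in> \<alpha> (p i))"
  have "\<exists>y. (s 0, y) \<in> \<alpha> x \<and> (\<exists>p. ?Q n y p)" for n
  proof -
    obtain p where p: "p 0 = x" "\<And>j. j < Suc n \<Longrightarrow> (s j, p (Suc j)) \<in> \<alpha> (p j)"
      using assms(2) unfolding emits_def by meson
    then show ?thesis
      by (intro exI[of _ "p 1"] conjI exI[of _ "p \<circ> Suc"]) (auto simp: p(1)[symmetric])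
  qed
  then obtain y where y: "\<And>n. (s 0, y n) \<in> \<alpha> x" "\<And>n. \<exists>p. ?Q n (y n) p" by metis
  have "finite (range y)"
    by (rule finite_subset[of _ "snd ` \<alpha> x"]) (use y(1) assms(1) in force)+
  then obtain k where k: "infinite {n. y n = y k}"
    using pigeonhole_infinite[of UNIV y] by auto
  have "emits \<alpha> (y k) (s \<circ> Suc)"
    unfolding emits_def
  proof
    fix n
    obtain m where "m > n" "y m = y k" using k unfolding infinite_nat_iff_unbounded by auto
    then obtain p where "?Q m (y k) p" using y(2)[of m] by auto
    then have "?Q n (y k) p" using \<open>m > n\<close> by auto
    then show "\<exists>p. ?Q n (y k) p" by blast
  qed
  then show ?thesis using y(1) by blast
qed

lemma productive_emits:
  assumes "lts A X \<alpha>" "productive X \<alpha>" "x \<in> X"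
  shows "\<exists>s. emits \<alpha> x s"
proof -
  \<comment> \<open>The conjunct with \<open>n = 0\<close> pins the start at \<open>x\<close>;
    membership in \<open>X\<close> lets productivity supply the next state.\<close>
  have "\<exists>p. \<forall>n::nat. (p n \<in> X \<and> (n = 0 \<longrightarrow> p n = x)) \<and> (\<exists>a. (a, p (Suc n)) \<in> \<alpha> (p n))"
  proof (rule dependent_nat_choice)
    show "\<exists>y. y \<in> X \<and> ((0::nat) = 0 \<longrightarrow> y = x)" using assms(3) by blast
    fix y and n :: nat assume y: "y \<in> X \<and> (n = 0 \<longrightarrow> y = x)"
    then obtain a z where "(a, z) \<in> \<alpha> y" using assms(2) unfolding productive_def by fastforce
    then show "\<exists>z. (z \<in> X \<and> (Suc n = 0 \<longrightarrow> z = x)) \<and> (\<exists>a. (a, z) \<in> \<alpha> y)"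
      using assms(1) y unfolding lts_def by blast
  qed
  then obtain p where p: "p 0 = x" "\<And>n. \<exists>a. (a, p (Suc n)) \<in> \<alpha> (p n)" by blast
  obtain s where "\<And>n. (s n, p (Suc n)) \<in> \<alpha> (p n)" using p(2) by metis
  then show ?thesis unfolding emits_def using p(1) by blast
qed

section \<open>Contractions\<close>

lemma closure_UN_finite:
  "finite I \<Longrightarrow> closure (\<Union>i\<in>I. S i) = (\<Union>i\<in>I. closure (S i))"
  by (induction I rule: finite_induct) auto

lemma prefix_map_add:
  "prefix_map \<sigma> s (n + k) = prefix_map \<sigma> s n \<circ> prefix_map \<sigma> (\<lambda>i. s (n + i)) k"
  by (induction k) (auto simp: comp_assoc)

text \<open>A ratio common to all labels gives the bound \<open>r ^ n\<close> for every word of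
  length \<open>n\<close>; \<open>0 \<le> r\<close> makes multiplication by it monotone.\<close>

locale contractions =
  fixes A :: "'a set" and \<sigma> :: "'a \<Rightarrow> 'm::complete_space \<Rightarrow> 'm" and r :: real
  assumes finite_labels: "finite A"
    and r: "0 \<le> r" "r < 1"
    and contraction: "a \<in> A \<Longrightarrow> dist (\<sigma> a p) (\<sigma> a q) \<le> r * dist p q"
begin

lemma dist_prefix_map:
  assumes "\<And>i. i < n \<Longrightarrow> s i \<in> A"
  shows "dist (prefix_map \<sigma> s n p) (prefix_map \<sigma> s n q) \<le> r ^ n * dist p q"
  using assms
proof (induction n arbitrary: p q)
  case (Suc n)
  have "dist (prefix_map \<sigma> s (Suc n) p) (prefix_map \<sigma> s (Suc n) q)
      \<le> r ^ n * dist (\<sigma> (s n) p) (\<sigma> (s n) q)"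
    using Suc by simp
  also have "\<dots> \<le> r ^ n * (r * dist p q)"
    using contraction[of "s n"] Suc.prems r by (intro mult_left_mono) auto
  finally show ?case by (simp add: mult_ac)
qed simp

text \<open>If every label moves \<open>p\<close> by at most \<open>D\<close>, then one more label
  turns a distance \<open>t\<close> from \<open>p\<close> into at most \<open>D + r * t\<close>. The
  radius \<open>D / (1 - r)\<close> is the fixed point of this bound.\<close>

lemma invariant_ball: "\<exists>R\<ge>0. \<forall>a\<in>A. \<forall>q\<in>cball p R. \<sigma> a q \<in> cball p R"
proof -
  define D where "D = Max (insert 0 ((\<lambda>a. dist p (\<sigma> a p)) ` A))"
  have D: "0 \<le> D" "\<And>a. a \<in> A \<Longrightarrow> dist p (\<sigma> a p) \<le> D"
    unfolding D_def using finite_labels by auto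
  have "dist p (\<sigma> a q) \<le> D / (1 - r)" if "a \<in> A" "dist p q \<le> D / (1 - r)" for a q
  proof -
    have "dist p (\<sigma> a q) \<le> D + r * dist p q"
      using dist_triangle[of p "\<sigma> a q" "\<sigma> a p"] D(2)[OF that(1)]
        contraction[OF that(1), of p q] by linarith
    also have "\<dots> \<le> D + r * (D / (1 - r))" using that r by (intro add_left_mono mult_left_mono) auto
    also have "\<dots> = D / (1 - r)" using r by (simp add: field_simps)
    finally show ?thesis .
  qed
  moreover have "0 \<le> D / (1 - r)" using D r by simp
  ultimately show ?thesis by (metis mem_cball)
qed

lemma bounded_prefix_maps:
  "\<exists>R. \<forall>s n. range s \<subseteq> A \<longrightarrow> dist p (prefix_map \<sigma> s n p) \<le> R"
proof -
  obtain R where R: "R \<ge> 0" "\<And>a q. a \<in> A \<Longrightarrow> q \<in> cball p R \<Longrightarrow> \<sigma> a q \<in> cball p R"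
    using invariant_ball by metis
  have "prefix_map \<sigma> s n q \<in> cball p R" if "q \<in> cball p R" "range s \<subseteq> A" for s n q
    using that
  proof (induction n arbitrary: q)
    case (Suc n)
    then have "\<sigma> (s n) q \<in> cball p R" by (intro R) auto
    then show ?case using Suc by simp
  qed auto
  then show ?thesis using R(1) by (metis centre_in_cball mem_cball)
qed

lemma power_times_tendsto_0: "(\<lambda>n. r ^ n * c) \<longlonglongrightarrow> 0"
  using tendsto_mult_left_zero[OF LIMSEQ_realpow_zero[OF r]] by simp

lemma tendsto_geometrically_close:
  assumes "f \<longlonglongrightarrow> (l::'m)" "\<And>n. dist (g n) (f n) \<le> r ^ n * c"
  shows "g \<longlonglongrightarrow> l"
proof -
  have "dist (g n) l \<le> r ^ n * c + dist (f n) l" for n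
    by (rule order_trans[OF dist_triangle add_right_mono[OF assms(2)]])
  then have "\<forall>\<^sub>F n in sequentially. norm (dist (g n) l) \<le> r ^ n * c + dist (f n) l"
    by simp
  moreover have "(\<lambda>n. r ^ n * c + dist (f n) l) \<longlonglongrightarrow> 0"
    using tendsto_add[OF power_times_tendsto_0[of c]] assms(1) unfolding tendsto_dist_iff[of f]
    by fastforce
  ultimately have "(\<lambda>n. dist (g n) l) \<longlonglongrightarrow> 0"
    by (rule Lim_null_comparison)
  then show ?thesis unfolding tendsto_dist_iff[of g] .
qed

text \<open>Prefixes of lengths \<open>n\<close> and \<open>n + k\<close> share their first
  \<open>n\<close> maps; the other \<open>k\<close> move the base point by a bounded amount, which
  the shared maps shrink by \<open>r ^ n\<close>. Changing the base point also costs only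
  \<open>r ^ n\<close> times a constant, so the description in \<open>sigma_omega\<close> has
  exactly one witness.\<close>

lemma sigma_omega_limit:
  assumes s: "range s \<subseteq> A"
  shows "(\<lambda>n. prefix_map \<sigma> s n p) \<longlonglongrightarrow> sigma_omega \<sigma> s"
proof -
  fix p0 :: 'm
  obtain R where R: "\<And>s n. range s \<subseteq> A \<Longrightarrow> dist p0 (prefix_map \<sigma> s n p0) \<le> R"
    using bounded_prefix_maps by blast
  have step: "dist (prefix_map \<sigma> s n p0) (prefix_map \<sigma> s (n + k) p0) \<le> r ^ n * R" for n k
  proof -
    have "dist (prefix_map \<sigma> s n p0) (prefix_map \<sigma> s (n + k) p0)
        \<le> r ^ n * dist p0 (prefix_map \<sigma> (\<lambda>i. s (n + i)) k p0)"
      unfolding prefix_map_add comp_apply using s by (intro dist_prefix_map) auto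
    also have "\<dots> \<le> r ^ n * R" using r s by (intro mult_left_mono R) auto
    finally show ?thesis .
  qed
  have "Cauchy (\<lambda>n. prefix_map \<sigma> s n p0)"
  proof (rule metric_CauchyI)
    fix e :: real assume "0 < e"
    then obtain N where N: "r ^ N * R < e / 2"
      using order_tendstoD(2)[OF power_times_tendsto_0[of R], of "e / 2"]
      by (auto simp: eventually_sequentially)
    have "dist (prefix_map \<sigma> s N p0) (prefix_map \<sigma> s n p0) < e / 2" if "n \<ge> N" for n
      using step[of N "n - N"] N that by simp
    then show "\<exists>M. \<forall>m\<ge>M. \<forall>n\<ge>M. dist (prefix_map \<sigma> s m p0) (prefix_map \<sigma> s n p0) < e"
      by (metis dist_commute dist_triangle_half_l)
  qed
  then obtain l where l: "(\<lambda>n. prefix_map \<sigma> s n p0) \<longlonglongrightarrow> l"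
    using Cauchy_convergent_iff convergent_def by metis
  have lim: "(\<lambda>n. prefix_map \<sigma> s n q) \<longlonglongrightarrow> l" for q
    by (rule tendsto_geometrically_close[OF l, of _ "dist q p0"])
      (use s in \<open>intro dist_prefix_map, auto\<close>)
  have "sigma_omega \<sigma> s = l"
    unfolding sigma_omega_def by (rule the_equality) (use lim LIMSEQ_unique in blast)+
  then show ?thesis using lim by simp
qed

lemma continuous_label:
  assumes "a \<in> A"
  shows "continuous_on S (\<sigma> a)"
proof -
  have "r-lipschitz_on S (\<sigma> a)"
    using contraction[OF assms] r by (intro lipschitz_onI) auto
  then show ?thesis by (rule lipschitz_on_continuous_on)
qed

lemma prefix_map_Suc_shift:
  "prefix_map \<sigma> s (Suc n) p = \<sigma> (s 0) (prefix_map \<sigma> (s \<circ> Suc) n p)"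
  using prefix_map_add[of \<sigma> s 1 n] by (simp add: comp_def)

lemma sigma_omega_unfold:
  assumes s: "range s \<subseteq> A"
  shows "sigma_omega \<sigma> s = \<sigma> (s 0) (sigma_omega \<sigma> (s \<circ> Suc))"
proof -
  fix p
  have "(\<lambda>n. \<sigma> (s 0) (prefix_map \<sigma> (s \<circ> Suc) n p)) \<longlonglongrightarrow> \<sigma> (s 0) (sigma_omega \<sigma> (s \<circ> Suc))"
    by (rule continuous_on_tendsto_compose[OF continuous_label[of "s 0" UNIV]])
      (use s in \<open>auto intro!: sigma_omega_limit\<close>)
  then have "(\<lambda>n. prefix_map \<sigma> s (Suc n) p) \<longlonglongrightarrow> \<sigma> (s 0) (sigma_omega \<sigma> (s \<circ> Suc))"
    by (simp add: prefix_map_Suc_shift del: prefix_map.simps)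
  then show ?thesis
    using LIMSEQ_Suc[OF sigma_omega_limit[OF s]] LIMSEQ_unique by blast
qed

section \<open>Solutions and limit sets of emitted streams\<close>

lemma solution_eq_state_sem:
  assumes X: "finite X" "lts A X \<alpha>" and \<phi>: "solution \<sigma> X \<alpha> \<phi>" and x: "x \<in> X"
  shows "\<phi> x = state_sem \<alpha> \<sigma> x"
proof -
  fix p0 :: 'm
  have compact: "\<And>y. y \<in> X \<Longrightarrow> compact (\<phi> y)"
    and nonempty: "\<And>y. y \<in> X \<Longrightarrow> \<phi> y \<noteq> {}"
    and unfold: "\<And>y. y \<in> X \<Longrightarrow> \<phi> y = (\<Union>(a, z)\<in>\<alpha> y. \<sigma> a ` \<phi> z)"
    using \<phi> unfolding solution_def by blast+
  have "bounded (\<Union>y\<in>X. \<phi> y)"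
    using X(1) compact compact_imp_bounded by blast
  then obtain R where R: "\<And>y q. y \<in> X \<Longrightarrow> q \<in> \<phi> y \<Longrightarrow> dist q p0 \<le> R"
    unfolding bounded_any_center[where a = p0] by (metis UN_iff dist_commute)
  \<comment> \<open>The base point may vary with \<open>n\<close>, because all values of \<phi> on
    \<open>X\<close> lie in one bounded set.\<close>
  have lim: "(\<lambda>n. prefix_map \<sigma> s n (q n)) \<longlonglongrightarrow> sigma_omega \<sigma> s"
    if s: "range s \<subseteq> A" and q: "\<And>n. q n \<in> \<phi> (y n)" "\<And>n. y n \<in> X" for s q y
  proof (rule tendsto_geometrically_close[OF sigma_omega_limit[OF s]])
    fix n
    have "dist (prefix_map \<sigma> s n (q n)) (prefix_map \<sigma> s n p0) \<le> r ^ n * dist (q n) p0"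
      using s by (intro dist_prefix_map) auto
    also have "\<dots> \<le> r ^ n * R" using R q r by (intro mult_left_mono) auto
    finally show "dist (prefix_map \<sigma> s n (q n)) (prefix_map \<sigma> s n p0) \<le> r ^ n * R" .
  qed
  \<comment> \<open>Read backwards along a path of length \<open>n\<close>, the equations carry any
    point of \<phi> at its end into \<open>\<phi> x\<close>; the limit stays there since
    \<open>\<phi> x\<close> is closed.\<close>
  have "sigma_omega \<sigma> s \<in> \<phi> x" if s: "emits \<alpha> x s" for s
  proof -
    have "\<exists>y\<in>X. \<exists>q\<in>\<phi> y. prefix_map \<sigma> s n q \<in> \<phi> x" for n
    proof -
      obtain p where p: "p 0 = x" "\<And>i. i < n \<Longrightarrow> (s i, p (Suc i)) \<in> \<alpha> (p i)"
        using s unfolding emits_def by blast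
      have pX: "p m \<in> X" if "m \<le> n" for m
        using path_in_carrier[OF X(2), of p n s m] p x that by auto
      have "prefix_map \<sigma> s m q \<in> \<phi> x" if "m \<le> n" "q \<in> \<phi> (p m)" for m q
        using that
      proof (induction m arbitrary: q)
        case (Suc m)
        then have "\<sigma> (s m) q \<in> \<phi> (p m)" using p(2)[of m] unfold[OF pX[of m]] by auto
        then show ?case using Suc by simp
      qed (use p in simp)
      then show ?thesis using nonempty pX by blast
    qed
    then obtain y q where yq: "\<And>n. y n \<in> X" "\<And>n. q n \<in> \<phi> (y n)"
        "\<And>n. prefix_map \<sigma> s n (q n) \<in> \<phi> x"
      by metis
    show ?thesis
      by (rule closed_sequentially[OF compact_imp_closed[OF compact[OF x]]])
        (rule yq(3), rule lim[OF emits_labels[OF X(2) x s] yq(2,1)])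
  qed
  \<comment> \<open>Each equation takes one label off the current point, starting from
    \<open>p\<close>. State and preimage are chosen together as a pair, so the prefix maps at the
    chosen points are constantly \<open>p\<close>.\<close>
  moreover have "\<exists>s. emits \<alpha> x s \<and> p = sigma_omega \<sigma> s" if p: "p \<in> \<phi> x" for p
  proof -
    have "\<exists>f. \<forall>n::nat. (fst (f n) \<in> X \<and> snd (f n) \<in> \<phi> (fst (f n)) \<and> (n = 0 \<longrightarrow> f n = (x, p))) \<and>
        (\<exists>a. (a, fst (f (Suc n))) \<in> \<alpha> (fst (f n)) \<and> snd (f n) = \<sigma> a (snd (f (Suc n))))"
    proof (rule dependent_nat_choice)
      show "\<exists>f. fst f \<in> X \<and> snd f \<in> \<phi> (fst f) \<and> ((0::nat) = 0 \<longrightarrow> f = (x, p))"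
        using x p by auto
      fix f and n :: nat
      assume f: "fst f \<in> X \<and> snd f \<in> \<phi> (fst f) \<and> (n = 0 \<longrightarrow> f = (x, p))"
      then obtain a z q where "(a, z) \<in> \<alpha> (fst f)" "q \<in> \<phi> z" "snd f = \<sigma> a q"
        using unfold[of "fst f"] by auto
      moreover have "z \<in> X" using \<open>(a, z) \<in> _\<close> f X(2) unfolding lts_def by blast
      ultimately show "\<exists>g. (fst g \<in> X \<and> snd g \<in> \<phi> (fst g) \<and> (Suc n = 0 \<longrightarrow> g = (x, p))) \<and>
          (\<exists>a. (a, fst g) \<in> \<alpha> (fst f) \<and> snd f = \<sigma> a (snd g))"
        by (intro exI[of _ "(z, q)"]) auto
    qed
    then obtain f where f: "f 0 = (x, p)" "\<And>n. fst (f n) \<in> X" "\<And>n. snd (f n) \<in> \<phi> (fst (f n))"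
        "\<And>n. \<exists>a. (a, fst (f (Suc n))) \<in> \<alpha> (fst (f n)) \<and> snd (f n) = \<sigma> a (snd (f (Suc n)))"
      by blast
    obtain s where s: "\<And>n. (s n, fst (f (Suc n))) \<in> \<alpha> (fst (f n))"
        "\<And>n. snd (f n) = \<sigma> (s n) (snd (f (Suc n)))"
      using f(4) by metis
    have emits: "emits \<alpha> x s"
      unfolding emits_def using f(1) s(1) by (intro allI exI[of _ "fst \<circ> f"]) auto
    have "prefix_map \<sigma> s n (snd (f n)) = p" for n
      by (induction n) (use f(1) in \<open>auto simp: s(2)[symmetric]\<close>)
    then have "p = sigma_omega \<sigma> s"
      using lim[OF emits_labels[OF X(2) x emits], of "snd \<circ> f" "fst \<circ> f"] f(2,3)
        LIMSEQ_const_iff[of p] by auto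
    then show ?thesis using emits by blast
  qed
  ultimately show ?thesis unfolding state_sem_def by blast
qed

section \<open>Compactness and existence of solutions\<close>

text \<open>A finite net for all limits at scale \<open>r ^ n * R\<close> gives one at scale
  \<open>r ^ Suc n * R\<close> by applying every label to it, because each limit is the image of the
  limit of the tail under the first label.\<close>

lemma compact_closure_self_similar_set: "compact (closure (self_similar_set A \<sigma>))"
  unfolding compact_eq_totally_bounded complete_eq_closed
proof (intro conjI allI impI)
  fix e :: real and p0 :: 'm assume e: "0 < e"
  obtain R where R: "\<And>s n. range s \<subseteq> A \<Longrightarrow> dist p0 (prefix_map \<sigma> s n p0) \<le> R"
    using bounded_prefix_maps by blast
  have dist_R: "dist p0 (sigma_omega \<sigma> s) \<le> R" if "range s \<subseteq> A" for s
    by (rule LIMSEQ_le_const2[OF tendsto_dist[OF tendsto_const sigma_omega_limit[OF that]]])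
      (use R[OF that] in blast)
  have cover: "\<exists>k. finite k \<and> (\<forall>s. range s \<subseteq> A \<longrightarrow> (\<exists>p\<in>k. dist p (sigma_omega \<sigma> s) \<le> r ^ n * R))"
    for n
  proof (induction n)
    case 0
    then show ?case using dist_R by (intro exI[of _ "{p0}"]) auto
  next
    case (Suc n)
    then obtain k where k: "finite k"
        "\<And>s. range s \<subseteq> A \<Longrightarrow> \<exists>p\<in>k. dist p (sigma_omega \<sigma> s) \<le> r ^ n * R" by blast
    have "\<exists>q\<in>(\<Union>a\<in>A. \<sigma> a ` k). dist q (sigma_omega \<sigma> s) \<le> r ^ Suc n * R" if s: "range s \<subseteq> A" for s
    proof -
      obtain p where p: "p \<in> k" "dist p (sigma_omega \<sigma> (s \<circ> Suc)) \<le> r ^ n * R"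
        using k(2)[of "s \<circ> Suc"] s by fastforce
      have "dist (\<sigma> (s 0) p) (sigma_omega \<sigma> s) \<le> r * dist p (sigma_omega \<sigma> (s \<circ> Suc))"
        unfolding sigma_omega_unfold[OF s] using s by (intro contraction) auto
      also have "\<dots> \<le> r * (r ^ n * R)" using p r by (intro mult_left_mono) auto
      finally show ?thesis using p(1) s by (intro bexI[of _ "\<sigma> (s 0) p"]) (auto simp: mult_ac)
    qed
    then show ?case
      using k(1) finite_labels by (intro exI[of _ "\<Union>a\<in>A. \<sigma> a ` k"]) auto
  qed
  obtain n where n: "r ^ n * R < e / 2"
    using order_tendstoD(2)[OF power_times_tendsto_0[of R], of "e / 2"] e
    by (auto simp: eventually_sequentially)
  obtain k where k: "finite k"
      "\<And>s. range s \<subseteq> A \<Longrightarrow> \<exists>p\<in>k. dist p (sigma_omega \<sigma> s) \<le> r ^ n * R"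
    using cover by blast
  \<comment> \<open>Finitely many closed balls have a closed union, so the cover survives the
    closure; radius \<open>e / 2\<close> leaves room for open balls of radius
    \<open>e\<close>.\<close>
  have "closure (self_similar_set A \<sigma>) \<subseteq> (\<Union>p\<in>k. cball p (e / 2))"
  proof (intro closure_minimal closed_UN)
    show "self_similar_set A \<sigma> \<subseteq> (\<Union>p\<in>k. cball p (e / 2))"
    proof
      fix q assume "q \<in> self_similar_set A \<sigma>"
      then obtain p where "p \<in> k" "dist p q \<le> r ^ n * R"
        using k(2) unfolding self_similar_set_def by blast
      then show "q \<in> (\<Union>p\<in>k. cball p (e / 2))" using n by (intro UN_I[of p]) auto
    qed
  qed (use k(1) in auto)
  also have "\<dots> \<subseteq> (\<Union>p\<in>k. ball p e)" using e by (intro UN_mono) auto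
  finally show "\<exists>k. finite k \<and> closure (self_similar_set A \<sigma>) \<subseteq> (\<Union>p\<in>k. ball p e)"
    using k(1) by blast
qed simp

text \<open>A continuous image of a closed set may fail to be closed; compactness of the closure
  rules this out.\<close>

lemma closure_label_image:
  assumes a: "a \<in> A" and S: "compact (closure S)"
  shows "closure (\<sigma> a ` S) = \<sigma> a ` closure S"
proof
  have "compact (\<sigma> a ` closure S)" by (rule compact_continuous_image[OF continuous_label[OF a] S])
  then show "closure (\<sigma> a ` S) \<subseteq> \<sigma> a ` closure S"
    by (intro closure_minimal image_mono closure_subset compact_imp_closed)
  show "\<sigma> a ` closure S \<subseteq> closure (\<sigma> a ` S)"
    by (rule image_closure_subset[OF continuous_label[OF a] _ closure_subset]) simp
qed

lemma state_sem_unfold: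
  assumes X: "finite X" "lts A X \<alpha>" and x: "x \<in> X"
  shows "state_sem \<alpha> \<sigma> x = (\<Union>(a, y)\<in>\<alpha> x. \<sigma> a ` state_sem \<alpha> \<sigma> y)"
proof (intro equalityI subsetI)
  fix p assume "p \<in> state_sem \<alpha> \<sigma> x"
  then obtain s where s: "emits \<alpha> x s" "p = sigma_omega \<sigma> s" unfolding state_sem_def by blast
  have "finite (\<alpha> x)"
    using X x finite_labels unfolding lts_def by (metis finite_SigmaI finite_subset)
  then obtain y where "(s 0, y) \<in> \<alpha> x" "emits \<alpha> y (s \<circ> Suc)" using emits_tail s(1) by metis
  then show "p \<in> (\<Union>(a, y)\<in>\<alpha> x. \<sigma> a ` state_sem \<alpha> \<sigma> y)"
    using s(2) sigma_omega_unfold[OF emits_labels[OF X(2) x s(1)]]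
    unfolding state_sem_def by blast
next
  fix p assume "p \<in> (\<Union>(a, y)\<in>\<alpha> x. \<sigma> a ` state_sem \<alpha> \<sigma> y)"
  then obtain a y s where s: "(a, y) \<in> \<alpha> x" "emits \<alpha> y s" "p = \<sigma> a (sigma_omega \<sigma> s)"
    unfolding state_sem_def by blast
  have e: "emits \<alpha> x (case_nat a s)" by (rule emits_Cons[OF s(1,2)])
  have "p = sigma_omega \<sigma> (case_nat a s)"
    using sigma_omega_unfold[OF emits_labels[OF X(2) x e]] s(3) by (simp add: comp_def)
  then show "p \<in> state_sem \<alpha> \<sigma> x" using e unfolding state_sem_def by blast
qed

text \<open>Closure commutes with the finite union over the successors and with each label, so the
  unfolding of the limit sets passes to their closures.\<close>

lemma solution_closure_state_sem:
  assumes X: "finite X" "lts A X \<alpha>" "productive X \<alpha>"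
  shows "solution \<sigma> X \<alpha> (\<lambda>x. closure (state_sem \<alpha> \<sigma> x))"
  unfolding solution_def
proof (intro ballI conjI)
  have compact: "compact (closure (state_sem \<alpha> \<sigma> x))" if "x \<in> X" for x
  proof -
    have "state_sem \<alpha> \<sigma> x \<subseteq> self_similar_set A \<sigma>"
      using emits_labels[OF X(2) that] unfolding state_sem_def self_similar_set_def by blast
    then show ?thesis
      by (metis closed_closure closure_mono compact_Int_closed compact_closure_self_similar_set
          inf.absorb_iff2)
  qed
  fix x assume x: "x \<in> X"
  show "compact (closure (state_sem \<alpha> \<sigma> x))" by (rule compact[OF x])
  show "closure (state_sem \<alpha> \<sigma> x) \<noteq> {}"
    using productive_emits[OF X(2,3) x] unfolding state_sem_def by auto
  have succ: "\<And>a y. (a, y) \<in> \<alpha> x \<Longrightarrow> a \<in> A \<and> y \<in> X"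
    using X x unfolding lts_def by blast
  have fin: "finite (\<alpha> x)"
    using X x finite_labels unfolding lts_def by (metis finite_SigmaI finite_subset)
  have "closure (state_sem \<alpha> \<sigma> x) = closure (\<Union>(a, y)\<in>\<alpha> x. \<sigma> a ` state_sem \<alpha> \<sigma> y)"
    using state_sem_unfold[OF X(1,2) x] by simp
  also have "\<dots> = (\<Union>z\<in>\<alpha> x. closure (\<sigma> (fst z) ` state_sem \<alpha> \<sigma> (snd z)))"
    using fin by (simp add: closure_UN_finite case_prod_beta)
  also have "\<dots> = (\<Union>(a, y)\<in>\<alpha> x. \<sigma> a ` closure (state_sem \<alpha> \<sigma> y))"
    by (intro SUP_cong) (use succ compact in \<open>auto simp: closure_label_image\<close>)
  finally show "closure (state_sem \<alpha> \<sigma> x) = (\<Union>(a, y)\<in>\<alpha> x. \<sigma> a ` closure (state_sem \<alpha> \<sigma> y))" .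
qed

end

lemma uniform_contraction_ratio:
  assumes "finite A" "\<sigma> \<in> A \<rightarrow> Con"
  shows "\<exists>r. contractions A \<sigma> r"
proof -
  have "\<exists>r<1. \<forall>p q. dist (\<sigma> a p) (\<sigma> a q) \<le> r * dist p q" if "a \<in> A" for a
    using assms(2) that unfolding Con_def by blast
  then obtain c where c: "\<And>a. a \<in> A \<Longrightarrow> c a < 1"
      "\<And>a p q. a \<in> A \<Longrightarrow> dist (\<sigma> a p) (\<sigma> a q) \<le> c a * dist p q"
    by metis
  \<comment> \<open>Inserting \<open>0\<close> makes the maximum nonnegative and keeps it defined
    when \<open>A\<close> is empty.\<close>
  define r where "r = Max (insert 0 (c ` A))"
  have r: "0 \<le> r" "r < 1" "\<And>a. a \<in> A \<Longrightarrow> c a \<le> r"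
    unfolding r_def using assms(1) c(1) by auto
  have "dist (\<sigma> a p) (\<sigma> a q) \<le> r * dist p q" if "a \<in> A" for a p q
    using c(2)[OF that, of p q] mult_right_mono[OF r(3)[OF that], of "dist p q"] by simp
  then show ?thesis using assms(1) r by (intro exI[of _ r]) (unfold_locales; blast)
qed

section \<open>Substitution of closed terms\<close>

text \<open>Unfolding a closed term substitutes only closed terms, so no binder is ever renamed and
  the choice made by \<open>binder_name\<close> plays no role.\<close>

definition admissible :: "(nat \<Rightarrow> 'a pterm) \<Rightarrow> bool" where
  "admissible \<rho> \<longleftrightarrow> (\<forall>v. \<rho> v = Var v \<or> fv (\<rho> v) = {})"

lemma admissible_Var [simp]: "admissible Var"
  by (simp add: admissible_def)

lemma admissible_upd [simp]:
  "admissible \<rho> \<Longrightarrow> t = Var w \<or> fv t = {} \<Longrightarrow> admissible (\<rho>(w := t))"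
  by (simp add: admissible_def)

lemmas admissible_upd_if [simp] = admissible_upd[unfolded fun_upd_def]

lemma unguarded_fv_subset: "unguarded_fv e \<subseteq> fv e"
  by (induction e) auto

lemma msubst_Mu:
  assumes "admissible \<rho>"
  shows "msubst (Mu w e) \<rho> = Mu w (msubst e (\<rho>(w := Var w)))"
proof -
  have "w \<notin> fv (\<rho> u)" if "u \<noteq> w" for u
    using assms that unfolding admissible_def by (metis empty_iff fv.simps(1) singletonD)
  then have "binder_name (\<Union>u\<in>fv e - {w}. fv (\<rho> u)) w = w"
    by (auto simp: binder_name_def)
  then show ?thesis by simp
qed

declare msubst.simps(4) [simp del]

lemma fv_msubst: "admissible \<rho> \<Longrightarrow> fv (msubst e \<rho>) = (\<Union>u\<in>fv e. fv (\<rho> u))"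
proof (induction e arbitrary: \<rho>)
  case (Mu w e)
  have "w \<notin> fv (\<rho> u)" if "u \<noteq> w" for u
    using Mu.prems that unfolding admissible_def by (metis empty_iff fv.simps(1) singletonD)
  then show ?case
    unfolding msubst_Mu[OF Mu.prems] fv.simps Mu.IH[OF admissible_upd[OF Mu.prems disjI1[OF refl]]]
    by (auto split: if_splits)
qed auto

lemma unguarded_fv_msubst:
  "admissible \<rho> \<Longrightarrow> unguarded_fv (msubst e \<rho>) = (\<Union>u\<in>unguarded_fv e. unguarded_fv (\<rho> u))"
proof (induction e arbitrary: \<rho>)
  case (Mu w e)
  have "w \<notin> unguarded_fv (\<rho> u)" if "u \<noteq> w" for u
    using Mu.prems that unguarded_fv_subset unfolding admissible_def
    by (metis empty_iff fv.simps(1) singletonD subsetD)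
  then show ?case
    unfolding msubst_Mu[OF Mu.prems] unguarded_fv.simps
      Mu.IH[OF admissible_upd[OF Mu.prems disjI1[OF refl]]]
    by (auto split: if_splits)
qed auto

text \<open>Substitution cannot create an unguarded occurrence of a bound variable: what it puts
  below the binder is another variable or closed.\<close>

lemma guarded_msubst:
  "admissible \<rho> \<Longrightarrow> guarded e \<Longrightarrow> (\<And>u. u \<in> fv e \<Longrightarrow> guarded (\<rho> u)) \<Longrightarrow> guarded (msubst e \<rho>)"
proof (induction e arbitrary: \<rho>)
  case (Mu w e)
  have "w \<notin> unguarded_fv (\<rho> u)" if "u \<noteq> w" for u
    using Mu.prems that unguarded_fv_subset unfolding admissible_def
    by (metis empty_iff fv.simps(1) singletonD subsetD)
  then have "w \<notin> unguarded_fv (msubst e (\<rho>(w := Var w)))"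
    using Mu.prems by (auto simp: unguarded_fv_msubst)
  moreover have "guarded (msubst e (\<rho>(w := Var w)))"
    by (rule Mu.IH) (use Mu.prems in auto)
  ultimately show ?case using Mu.prems by (simp add: msubst_Mu)
qed auto

lemma labels_msubst:
  "admissible \<rho> \<Longrightarrow> labels (msubst e \<rho>) \<subseteq> labels e \<union> (\<Union>u\<in>fv e. labels (\<rho> u))"
proof (induction e arbitrary: \<rho>)
  case (Mu w e)
  have "labels (msubst e (\<rho>(w := Var w))) \<subseteq>
      labels e \<union> (\<Union>u\<in>fv e. labels ((\<rho>(w := Var w)) u))"
    by (rule Mu.IH) (use Mu.prems in simp)
  also have "\<dots> \<subseteq> labels e \<union> (\<Union>u\<in>fv e - {w}. labels (\<rho> u))"
    by (auto split: if_splits)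
  finally show ?case using Mu.prems by (simp add: msubst_Mu)
qed fastforce+

lemma process_terms_msubst:
  assumes "admissible \<rho>" "guarded e" "labels e \<subseteq> A" "\<And>u. u \<in> fv e \<Longrightarrow> \<rho> u \<in> process_terms A"
  shows "msubst e \<rho> \<in> process_terms A"
  using assms labels_msubst[of \<rho> e] guarded_msubst[of \<rho> e]
  unfolding process_terms_def by (simp add: fv_msubst) blast

lemma msubst_ident:
  "admissible \<rho> \<Longrightarrow> (\<And>v. v \<in> fv e \<Longrightarrow> \<rho> v = Var v) \<Longrightarrow> msubst e \<rho> = e"
  by (induction e arbitrary: \<rho>) (auto simp: msubst_Mu)

text \<open>Under a binder both environments are reset at \<open>w\<close>, and so must be their
  composite. This works because every \<open>\<rho> v\<close> other than \<open>Var v\<close> is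
  closed and thus left alone by \<tau>.\<close>

lemma msubst_msubst:
  "admissible \<rho> \<Longrightarrow> admissible \<tau> \<Longrightarrow> msubst (msubst e \<rho>) \<tau> = msubst e (\<lambda>v. msubst (\<rho> v) \<tau>)"
proof (induction e arbitrary: \<rho> \<tau>)
  case (Mu w e)
  have closed: "msubst (\<rho> v) \<tau>' = \<rho> v" if "\<rho> v \<noteq> Var v" "admissible \<tau>'" for v \<tau>'
    using that Mu.prems(1) by (intro msubst_ident) (auto simp: admissible_def)
  have adm: "admissible (\<lambda>v. msubst (\<rho> v) \<tau>)"
    unfolding admissible_def
  proof
    fix v
    show "msubst (\<rho> v) \<tau> = Var v \<or> fv (msubst (\<rho> v) \<tau>) = {}"
      using closed[of v \<tau>] Mu.prems by (cases "\<rho> v = Var v") (auto simp: admissible_def)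
  qed
  have "(\<lambda>v. msubst ((\<rho>(w := Var w)) v) (\<tau>(w := Var w))) = (\<lambda>v. msubst (\<rho> v) \<tau>)(w := Var w)"
  proof
    fix v
    show "msubst ((\<rho>(w := Var w)) v) (\<tau>(w := Var w)) = ((\<lambda>v. msubst (\<rho> v) \<tau>)(w := Var w)) v"
      using closed[of v] Mu.prems by (cases "\<rho> v = Var v") auto
  qed
  moreover have "msubst (msubst e (\<rho>(w := Var w))) (\<tau>(w := Var w)) =
      msubst e (\<lambda>v. msubst ((\<rho>(w := Var w)) v) (\<tau>(w := Var w)))"
    by (rule Mu.IH) (use Mu.prems in auto)
  ultimately show ?case using Mu.prems adm by (simp only: msubst_Mu)
qed auto

lemma step_Prefix_iff: "step (Prefix b e) a f \<longleftrightarrow> a = b \<and> f = e"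
  by (auto elim: step.cases intro: step.prefix)

lemma step_Plus_iff: "step (Plus e1 e2) a f \<longleftrightarrow> step e1 a f \<or> step e2 a f"
  by (auto elim: step.cases intro: step.plus_left step.plus_right)

lemma step_Mu_iff: "step (Mu v e) a f \<longleftrightarrow> step (subst e (Mu v e) v) a f"
  by (auto elim: step.cases intro: step.mu)

text \<open>Unfolding becomes an update of the environment while the term shrinks to the body
  \<open>e\<close>, which makes structural induction available for transitions.\<close>

lemma step_msubst_Mu:
  assumes \<rho>: "admissible \<rho>" and closed: "fv (msubst (Mu w e) \<rho>) = {}"
  shows "step (msubst (Mu w e) \<rho>) a f \<longleftrightarrow> step (msubst e (\<rho>(w := msubst (Mu w e) \<rho>))) a f"
proof -
  let ?g = "msubst (Mu w e) \<rho>"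
  have "(\<lambda>v. msubst ((\<rho>(w := Var w)) v) (Var(w := ?g))) = \<rho>(w := ?g)"
  proof
    fix v
    show "msubst ((\<rho>(w := Var w)) v) (Var(w := ?g)) = (\<rho>(w := ?g)) v"
      using \<rho> closed msubst_ident[of "Var(w := ?g)" "\<rho> v"]
      by (cases "\<rho> v = Var v") (auto simp: admissible_def)
  qed
  then have "subst (msubst e (\<rho>(w := Var w))) ?g w = msubst e (\<rho>(w := ?g))"
    unfolding subst_def using \<rho> closed by (simp add: msubst_msubst)
  then show ?thesis using \<rho> by (metis msubst_Mu step_Mu_iff)
qed

section \<open>Finitely many derivatives of a process term\<close>

lemma process_terms_step:
  "step e a f \<Longrightarrow> e \<in> process_terms A \<Longrightarrow> a \<in> A \<and> f \<in> process_terms A"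
proof (induction rule: step.induct)
  case (mu e v a f)
  have "subst e (Mu v e) v \<in> process_terms A"
    unfolding subst_def using mu.prems
    by (intro process_terms_msubst) (auto simp: process_terms_def)
  then show ?case by (rule mu.IH)
qed (auto simp: process_terms_def)

text \<open>The recursion variable is guarded in the body, so the premise on unguarded variables
  never asks for a transition of the recursive term itself.\<close>

lemma msubst_step_exists:
  assumes "admissible \<rho>" "guarded e" "\<And>v. v \<in> fv e \<Longrightarrow> fv (\<rho> v) = {}"
    "\<And>v. v \<in> unguarded_fv e \<Longrightarrow> \<exists>a f. step (\<rho> v) a f"
  shows "\<exists>a f. step (msubst e \<rho>) a f"
  using assms
proof (induction e arbitrary: \<rho>)
  case (Mu w e)
  let ?g = "msubst (Mu w e) \<rho>"
  have g: "fv ?g = {}" using Mu.prems by (simp add: fv_msubst)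
  have "\<exists>a f. step (msubst e (\<rho>(w := ?g))) a f"
    by (rule Mu.IH) (use Mu.prems g in auto)
  then show ?case using step_msubst_Mu[OF Mu.prems(1) g] by blast
next
  case (Plus e1 e2)
  then show ?case by (simp add: step_Plus_iff) blast
next
  case (Prefix a e)
  then show ?case by (auto intro: step.prefix)
qed auto

lemma process_terms_step_exists:
  assumes "e \<in> process_terms A"
  shows "\<exists>a f. step e a f"
  using assms msubst_step_exists[of Var e] unguarded_fv_subset[of e] msubst_ident[of Var e]
  by (auto simp: process_terms_def)

text \<open>Guardedness makes the case of a binder work: a transition of the unfolded body that comes
  from the recursion variable is a transition of the recursive term itself, and thus one of the
  unfolded body that does not come from the recursion variable.\<close>

lemma finite_derivatives_msubst:
  assumes "admissible \<rho>" "guarded e" "\<And>v. v \<in> fv e \<Longrightarrow> fv (\<rho> v) = {}"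
  shows "\<exists>S. finite S \<and>
    (\<forall>a f. step (msubst e \<rho>) a f \<longrightarrow> f \<in> S \<or> (\<exists>v\<in>unguarded_fv e. step (\<rho> v) a f)) \<and>
    (\<forall>g\<in>S. \<forall>a f. step g a f \<longrightarrow> f \<in> S \<or> (\<exists>v\<in>fv e. step (\<rho> v) a f))"
  using assms
proof (induction e arbitrary: \<rho>)
  case (Var v)
  show ?case by (rule exI[of _ "{}"]) simp
next
  case (Prefix a e)
  have prems: "guarded e" "\<And>v. v \<in> fv e \<Longrightarrow> fv (\<rho> v) = {}"
    using Prefix.prems by auto
  obtain S where S: "finite S"
      "\<forall>a f. step (msubst e \<rho>) a f \<longrightarrow> f \<in> S \<or> (\<exists>v\<in>unguarded_fv e. step (\<rho> v) a f)"
      "\<forall>g\<in>S. \<forall>a f. step g a f \<longrightarrow> f \<in> S \<or> (\<exists>v\<in>fv e. step (\<rho> v) a f)"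
    using Prefix.IH[OF Prefix.prems(1) prems] by blast
  \<comment> \<open>The body exposes variables that the prefix guarded; hence the bound for members
    of the set has \<open>fv\<close> in place of \<open>unguarded_fv\<close>.\<close>
  then show ?case
    using unguarded_fv_subset[of e]
    by (intro exI[of _ "insert (msubst e \<rho>) S"]) (auto simp: step_Prefix_iff; blast)
next
  case (Plus e1 e2)
  have prems: "guarded e1" "guarded e2" "\<And>v. v \<in> fv e1 \<Longrightarrow> fv (\<rho> v) = {}"
      "\<And>v. v \<in> fv e2 \<Longrightarrow> fv (\<rho> v) = {}"
    using Plus.prems by auto
  obtain S1 where S1: "finite S1"
      "\<forall>a f. step (msubst e1 \<rho>) a f \<longrightarrow> f \<in> S1 \<or> (\<exists>v\<in>unguarded_fv e1. step (\<rho> v) a f)"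
      "\<forall>g\<in>S1. \<forall>a f. step g a f \<longrightarrow> f \<in> S1 \<or> (\<exists>v\<in>fv e1. step (\<rho> v) a f)"
    using Plus.IH(1)[OF Plus.prems(1) prems(1,3)] by blast
  obtain S2 where S2: "finite S2"
      "\<forall>a f. step (msubst e2 \<rho>) a f \<longrightarrow> f \<in> S2 \<or> (\<exists>v\<in>unguarded_fv e2. step (\<rho> v) a f)"
      "\<forall>g\<in>S2. \<forall>a f. step g a f \<longrightarrow> f \<in> S2 \<or> (\<exists>v\<in>fv e2. step (\<rho> v) a f)"
    using Plus.IH(2)[OF Plus.prems(1) prems(2,4)] by blast
  show ?case
    using S1 S2 by (intro exI[of _ "S1 \<union> S2"]) (simp add: step_Plus_iff ball_Un bex_Un, blast)
next
  case (Mu w e)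
  let ?g = "msubst (Mu w e) \<rho>"
  have g: "fv ?g = {}" using Mu.prems by (simp add: fv_msubst)
  have "\<exists>S. finite S \<and>
      (\<forall>a f. step (msubst e (\<rho>(w := ?g))) a f \<longrightarrow>
        f \<in> S \<or> (\<exists>v\<in>unguarded_fv e. step ((\<rho>(w := ?g)) v) a f)) \<and>
      (\<forall>h\<in>S. \<forall>a f. step h a f \<longrightarrow> f \<in> S \<or> (\<exists>v\<in>fv e. step ((\<rho>(w := ?g)) v) a f))"
    by (rule Mu.IH) (use Mu.prems g in auto)
  then obtain S where S: "finite S"
      "\<And>a f. step ?g a f \<Longrightarrow> f \<in> S \<or> (\<exists>v\<in>unguarded_fv e. step ((\<rho>(w := ?g)) v) a f)"
      "\<And>h a f. h \<in> S \<Longrightarrow> step h a f \<Longrightarrow> f \<in> S \<or> (\<exists>v\<in>fv e. step ((\<rho>(w := ?g)) v) a f)"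
    unfolding step_msubst_Mu[OF Mu.prems(1) g, symmetric] by auto
  have top: "f \<in> S \<or> (\<exists>v\<in>unguarded_fv (Mu w e). step (\<rho> v) a f)" if st: "step ?g a f" for a f
  proof -
    have "w \<notin> unguarded_fv e" using Mu.prems(2) by simp
    then show ?thesis using S(2)[OF st] by (auto split: if_splits)
  qed
  have "f \<in> S \<or> (\<exists>v\<in>fv (Mu w e). step (\<rho> v) a f)" if h: "h \<in> S" and st: "step h a f" for h a f
  proof -
    consider "f \<in> S" | "step ?g a f" | v where "v \<in> fv (Mu w e)" "step (\<rho> v) a f"
      using S(3)[OF h st] by (auto split: if_splits)
    then show ?thesis using top unguarded_fv_subset[of "Mu w e"] by cases blast+
  qed
  then show ?case using S(1) top by blast
qed

lemma finite_derivatives: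
  assumes e: "e \<in> process_terms A"
  shows "\<exists>T. finite T \<and> e \<in> T \<and> T \<subseteq> process_terms A \<and> (\<forall>g\<in>T. \<forall>a f. step g a f \<longrightarrow> f \<in> T)"
proof -
  have "msubst e Var = e" "fv e = {}" "unguarded_fv e = {}" "guarded e"
    using e unguarded_fv_subset[of e] by (auto simp: process_terms_def intro: msubst_ident)
  then obtain S where S: "finite S" "\<And>a f. step e a f \<Longrightarrow> f \<in> S"
      "\<And>g a f. g \<in> S \<Longrightarrow> step g a f \<Longrightarrow> f \<in> S"
    using finite_derivatives_msubst[of Var e] by auto
  \<comment> \<open>The set \<open>S\<close> is not known to consist of process terms. Cutting it
    down to them loses no successor of the terms that remain, since transitions preserve process
    terms.\<close>
  have "\<forall>g\<in>insert e (S \<inter> process_terms A). \<forall>a f. step g a f \<longrightarrow>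
      f \<in> insert e (S \<inter> process_terms A)"
  proof (intro ballI allI impI)
    fix g a f assume g: "g \<in> insert e (S \<inter> process_terms A)" "step g a f"
    then have "f \<in> S" using S by auto
    moreover have "f \<in> process_terms A" using process_terms_step[OF g(2)] g(1) e by blast
    ultimately show "f \<in> insert e (S \<inter> process_terms A)" by blast
  qed
  then show ?thesis
    using S(1) e by (intro exI[of _ "insert e (S \<inter> process_terms A)"]) auto
qed

text \<open>The derivatives are terms, whereas states must have type \<open>'x\<close>. A bijection
  onto a set of equal size in \<open>'x\<close> carries the transitions over, and its graph is the
  bisimulation.\<close>

lemma process_term_finite_lts:
  fixes e :: "'a pterm"
  assumes e: "e \<in> process_terms A" and infinite: "infinite (UNIV :: 'x set)"
  shows "\<exists>(X :: 'x set) \<alpha>. finite X \<and> lts A X \<alpha> \<and> productive X \<alpha> \<and>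
    (\<exists>x\<in>X. \<forall>s. emits \<alpha> x s \<longleftrightarrow> emits term_lts e s)"
proof -
  obtain T where T: "finite T" "e \<in> T" "T \<subseteq> process_terms A"
      "\<forall>g\<in>T. \<forall>a f. step g a f \<longrightarrow> f \<in> T"
    using finite_derivatives[OF e] by auto
  obtain X :: "'x set" where "finite X" "card X = card T"
    using infinite_arbitrarily_large[OF infinite] by blast
  then obtain \<iota> where \<iota>: "bij_betw \<iota> T X" using T(1) finite_same_card_bij by metis
  define \<alpha> where "\<alpha> x = map_prod id \<iota> ` term_lts (inv_into T \<iota> x)" for x
  have \<alpha>: "\<alpha> (\<iota> g) = map_prod id \<iota> ` term_lts g" if "g \<in> T" for g
    using that \<iota> by (simp add: \<alpha>_def bij_betw_def)
  have X: "X = \<iota> ` T" using \<iota> by (simp add: bij_betw_def)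
  have step_T: "a \<in> A \<and> f \<in> T" if "g \<in> T" "step g a f" for g a f
    using that T(4) process_terms_step[OF that(2), of A] T(3) by auto
  have "lts A X \<alpha>"
    unfolding lts_def X using step_T by (auto simp: \<alpha> term_lts_def)
  moreover have "productive X \<alpha>"
    unfolding productive_def X using process_terms_step_exists[OF subsetD[OF T(3)]]
    by (auto simp: \<alpha> term_lts_def)
  moreover have "emits \<alpha> (\<iota> e) s \<longleftrightarrow> emits term_lts e s" for s
  proof (rule emits_bisimulation[where R = "\<lambda>x g. g \<in> T \<and> x = \<iota> g"])
    fix x g a y assume "g \<in> T \<and> x = \<iota> g" "(a, y) \<in> \<alpha> x"
    then show "\<exists>f. (a, f) \<in> term_lts g \<and> f \<in> T \<and> y = \<iota> f"
      using step_T by (auto simp: \<alpha> term_lts_def)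
  next
    fix x g a f assume "g \<in> T \<and> x = \<iota> g" "(a, f) \<in> term_lts g"
    then show "\<exists>y. (a, y) \<in> \<alpha> x \<and> f \<in> T \<and> y = \<iota> f"
      using step_T by (force simp: \<alpha> term_lts_def)
  qed (use T(2) in simp)
  ultimately show ?thesis using T(2) \<open>finite X\<close> X by blast
qed

section \<open>Process terms for the states of a finite system\<close>

text \<open>The value on the empty list is arbitrary.\<close>

fun sum_terms :: "'a pterm list \<Rightarrow> 'a pterm" where
  "sum_terms [] = Var 0"
| "sum_terms (e # es) = (if es = [] then e else Plus e (sum_terms es))"

lemma sum_terms_syntax:
  assumes "es \<noteq> []"
  shows "fv (sum_terms es) = (\<Union>e\<in>set es. fv e)"
    and "unguarded_fv (sum_terms es) = (\<Union>e\<in>set es. unguarded_fv e)"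
    and "labels (sum_terms es) = (\<Union>e\<in>set es. labels e)"
    and "guarded (sum_terms es) \<longleftrightarrow> (\<forall>e\<in>set es. guarded e)"
  using assms by (induction es) auto

lemma msubst_sum_terms:
  "es \<noteq> [] \<Longrightarrow> msubst (sum_terms es) \<rho> = sum_terms (map (\<lambda>e. msubst e \<rho>) es)"
  by (induction es) auto

lemma step_sum_terms: "es \<noteq> [] \<Longrightarrow> step (sum_terms es) a f \<longleftrightarrow> (\<exists>e\<in>set es. step e a f)"
  by (induction es) (auto simp: step_Plus_iff)

text \<open>The set \<open>V\<close> holds the states whose binder is in scope. The first argument bounds the number
  of states outside \<open>V\<close>; as long as it does, the first equation applies only to states in \<open>V\<close>.\<close>

primrec state_term ::
    "nat \<Rightarrow> ('x \<Rightarrow> ('a \<times> 'x) set) \<Rightarrow> ('x \<Rightarrow> nat) \<Rightarrow> 'x set \<Rightarrow> 'x \<Rightarrow> 'a pterm" where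
  "state_term 0 \<alpha> \<iota> V x = Var (\<iota> x)"
| "state_term (Suc n) \<alpha> \<iota> V x =
    (if x \<in> V then Var (\<iota> x)
     else Mu (\<iota> x) (sum_terms (map (\<lambda>(a, y). Prefix a (state_term n \<alpha> \<iota> (insert x V) y))
       (SOME ys. set ys = \<alpha> x))))"

text \<open>\<open>\<iota> x\<close> is the recursion variable of state \<open>x\<close>;
  injectivity keeps binders of distinct states from shadowing each other.\<close>

locale finite_productive_lts =
  fixes A :: "'a set" and X :: "'x set" and \<alpha> :: "'x \<Rightarrow> ('a \<times> 'x) set" and \<iota> :: "'x \<Rightarrow> nat"
  assumes finite_labels: "finite A" and finite_states: "finite X"
    and lts: "lts A X \<alpha>" and productive: "productive X \<alpha>" and inj: "inj_on \<iota> X"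
begin

lemma successors:
  assumes "x \<in> X"
  shows "set (SOME ys. set ys = \<alpha> x) = \<alpha> x" "(SOME ys. set ys = \<alpha> x) \<noteq> []"
proof -
  have "finite (\<alpha> x)"
    using lts finite_labels finite_states assms unfolding lts_def
    by (metis finite_SigmaI finite_subset)
  then show *: "set (SOME ys. set ys = \<alpha> x) = \<alpha> x"
    using finite_list[of "\<alpha> x"] by (metis (mono_tags, lifting) someI_ex)
  show "(SOME ys. set ys = \<alpha> x) \<noteq> []"
    using * productive assms unfolding productive_def by (metis list.set(1))
qed

lemma successor_in:
  "x \<in> X \<Longrightarrow> (a, y) \<in> \<alpha> x \<Longrightarrow> a \<in> A \<and> y \<in> X"
  using lts unfolding lts_def by blast

text \<open>Binding \<open>x\<close> costs one unit of the bound and removes one state from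
  \<open>X - V\<close>, so the bound is never \<open>0\<close> at a state whose binder is
  missing.\<close>

lemma card_remaining:
  assumes "x \<in> X" "x \<notin> V" "card (X - V) \<le> n"
  obtains m where "n = Suc m" "card (X - insert x V) \<le> m"
proof -
  have "card (X - insert x V) < card (X - V)"
    by (rule psubset_card_mono) (use assms finite_states in auto)
  then show ?thesis using that[of "n - 1"] assms(3) by auto
qed

text \<open>Guardedness holds by construction: every summand of a binder body is a prefix, so the
  body has no unguarded variable.\<close>

lemma state_term_syntax:
  assumes "V \<subseteq> X" "x \<in> X" "card (X - V) \<le> n"
  shows "fv (state_term n \<alpha> \<iota> V x) \<subseteq> \<iota> ` V \<and> guarded (state_term n \<alpha> \<iota> V x) \<and>
    labels (state_term n \<alpha> \<iota> V x) \<subseteq> A"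
  using assms
proof (induction n arbitrary: V x)
  case 0
  then show ?case using finite_states by auto
next
  case (Suc n)
  show ?case
  proof (cases "x \<in> V")
    case False
    have IH: "fv (state_term n \<alpha> \<iota> (insert x V) y) \<subseteq> \<iota> ` insert x V \<and>
        guarded (state_term n \<alpha> \<iota> (insert x V) y) \<and>
        labels (state_term n \<alpha> \<iota> (insert x V) y) \<subseteq> A" if "(a, y) \<in> \<alpha> x" for a y
      by (rule Suc.IH)
        (use Suc.prems False that successor_in card_remaining[of x V "Suc n"] in auto)
    show ?thesis
      using False successors[OF Suc.prems(2)] IH successor_in[OF Suc.prems(2)]
      by (auto simp: sum_terms_syntax split_beta) fastforce+
  qed auto
qed

text \<open>Relates a state to the closed instances of its terms in which every free variable is
  replaced by a term related to the state that the variable stands for.\<close>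

inductive represents :: "'x \<Rightarrow> 'a pterm \<Rightarrow> bool" where
  "V \<subseteq> X \<Longrightarrow> x \<in> X \<Longrightarrow> card (X - V) \<le> n \<Longrightarrow> admissible \<rho> \<Longrightarrow>
    (\<And>v. v \<in> V \<Longrightarrow> fv (\<rho> (\<iota> v)) = {}) \<Longrightarrow> (\<And>v. v \<in> V \<Longrightarrow> represents v (\<rho> (\<iota> v))) \<Longrightarrow>
    represents x (msubst (state_term n \<alpha> \<iota> V x) \<rho>)"

text \<open>A state in \<open>V\<close> inherits the claim from the term replacing its variable, by
  rule induction. For any other state the term is a binder; its transitions are those of the body
  with the term itself put for the variable, and that term may enter the environment because it
  represents the state.\<close>

lemma represents_bisimulation:
  assumes "represents x t"
  shows "((a, y) \<in> \<alpha> x \<longrightarrow> (\<exists>f. step t a f \<and> represents y f)) \<and>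
    (step t a g \<longrightarrow> (\<exists>y. (a, y) \<in> \<alpha> x \<and> represents y g))"
  using assms
proof (induction arbitrary: a y g)
  case (1 V x n \<rho>)
  show ?case
  proof (cases "x \<in> V")
    case True
    then have "state_term n \<alpha> \<iota> V x = Var (\<iota> x)" by (cases n) auto
    then show ?thesis using "1.IH"[OF True] by simp
  next
    case False
    let ?t = "msubst (state_term n \<alpha> \<iota> V x) \<rho>"
    obtain m where m: "n = Suc m" "card (X - insert x V) \<le> m"
      using card_remaining[OF "1.hyps"(2) False "1.hyps"(3)] .
    define ys where "ys = (SOME ys. set ys = \<alpha> x)"
    have ys: "set ys = \<alpha> x" "ys \<noteq> []" using successors[OF "1.hyps"(2)] by (auto simp: ys_def)
    define body where
      "body = sum_terms (map (\<lambda>(a, y). Prefix a (state_term m \<alpha> \<iota> (insert x V) y)) ys)"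
    have t: "state_term n \<alpha> \<iota> V x = Mu (\<iota> x) body"
      using False m by (simp add: body_def ys_def)
    have t_rep: "represents x ?t" by (rule represents.intros) (use 1 in auto)
    have closed: "fv ?t = {}"
      using state_term_syntax[OF "1.hyps"(1,2,3)] "1.hyps"(4,5) by (auto simp: fv_msubst)
    define \<rho>' where "\<rho>' = \<rho>(\<iota> x := ?t)"
    have step: "step ?t b f \<longleftrightarrow>
        (\<exists>z. (b, z) \<in> \<alpha> x \<and> f = msubst (state_term m \<alpha> \<iota> (insert x V) z) \<rho>')" for b f
    proof -
      have "step ?t b f \<longleftrightarrow> step (msubst body \<rho>') b f"
        unfolding \<rho>'_def t by (rule step_msubst_Mu[OF "1.hyps"(4) closed[unfolded t]])
      also have "\<dots> \<longleftrightarrow> (\<exists>z. (b, z) \<in> \<alpha> x \<and> f = msubst (state_term m \<alpha> \<iota> (insert x V) z) \<rho>')"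
        using ys unfolding body_def
        by (auto simp: msubst_sum_terms step_sum_terms step_Prefix_iff split_beta) force
      finally show ?thesis .
    qed
    have \<rho>': "\<rho>' (\<iota> v) = (if v = x then ?t else \<rho> (\<iota> v))" if "v \<in> insert x V" for v
      using that inj "1.hyps"(1,2) unfolding \<rho>'_def by (auto dest: inj_onD)
    have succ: "represents z (msubst (state_term m \<alpha> \<iota> (insert x V) z) \<rho>')" if z: "(b, z) \<in> \<alpha> x" for b z
    proof (rule represents.intros)
      show "insert x V \<subseteq> X" "z \<in> X" "card (X - insert x V) \<le> m"
        using "1.hyps"(1,2) successor_in z m(2) by auto
      show "admissible \<rho>'" unfolding \<rho>'_def using "1.hyps"(4) closed by simp
      fix v assume v: "v \<in> insert x V"
      show "fv (\<rho>' (\<iota> v)) = {}" "represents v (\<rho>' (\<iota> v))"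
        unfolding \<rho>'[OF v] using v closed t_rep "1.hyps"(5,6) by auto
    qed
    show ?thesis unfolding step using succ by auto
  qed
qed

lemma exists_process_term:
  assumes "x \<in> X"
  shows "\<exists>e\<in>process_terms A. \<forall>s. emits \<alpha> x s \<longleftrightarrow> emits term_lts e s"
proof (intro bexI allI)
  \<comment> \<open>No binder is in scope at the start, so all of \<open>X\<close> remains and
    \<open>card X\<close> is a sufficient bound.\<close>
  define e where "e = state_term (card X) \<alpha> \<iota> {} x"
  show e: "e \<in> process_terms A"
    using state_term_syntax[of "{}" x "card X"] assms unfolding e_def process_terms_def by auto
  have "represents x (msubst e Var)"
    unfolding e_def by (rule represents.intros) (use assms in auto)
  then have "represents x e" using e by (simp add: msubst_ident)
  then show "emits \<alpha> x s \<longleftrightarrow> emits term_lts e s" for s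
    by (intro emits_bisimulation[where R = represents])
      (use represents_bisimulation in \<open>auto simp: term_lts_def\<close>)
qed

end

section \<open>Regular subfractals\<close>

(* The state sets X range over the finite subsets of an arbitrary infinite type 'x. Such a type
   contains a copy of every finite set, so this is existence of a finite LTS. *)
theorem mainTheorem3:
  fixes A :: "'a set"
    and \<sigma> :: "'a \<Rightarrow> 'm::complete_space \<Rightarrow> 'm"
    and K :: "'m set"
  assumes "finite A"
    and "\<sigma> \<in> A \<rightarrow> Con"
    and "K \<subseteq> self_similar_set A \<sigma>"
    and "infinite (UNIV :: 'x set)"
  shows "regular_subfractal A \<sigma> K \<longleftrightarrow>
    (\<exists>(X :: 'x set) \<alpha>. finite X \<and> lts A X \<alpha> \<and> productive X \<alpha> \<and>
      (\<exists>x\<in>X. \<exists>\<phi>. solution \<sigma> X \<alpha> \<phi> \<and> K = \<phi> x))"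
proof -
  obtain r where "contractions A \<sigma> r" using uniform_contraction_ratio assms(1,2) by blast
  then interpret contractions A \<sigma> r .
  show ?thesis
  proof
    assume "regular_subfractal A \<sigma> K"
    then obtain e where e: "e \<in> process_terms A" "K = state_sem term_lts \<sigma> e"
      unfolding regular_subfractal_def by blast
    obtain X :: "'x set" and \<alpha> x where X: "finite X" "lts A X \<alpha>" "productive X \<alpha>" "x \<in> X"
        "\<And>s. emits \<alpha> x s \<longleftrightarrow> emits term_lts e s"
      using process_term_finite_lts[OF e(1) assms(4)] by blast
    have sol: "solution \<sigma> X \<alpha> (\<lambda>x. closure (state_sem \<alpha> \<sigma> x))"
      by (rule solution_closure_state_sem[OF X(1,2,3)])
    have "K = state_sem \<alpha> \<sigma> x" unfolding e(2) state_sem_def X(5) ..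
    \<comment> \<open>The value of the solution \<open>sol\<close> at \<open>x\<close> is the limit
      set itself, so the closure adds no points.\<close>
    then have "K = closure (state_sem \<alpha> \<sigma> x)"
      using solution_eq_state_sem[OF X(1,2) sol X(4)] by simp
    then show "\<exists>(X :: 'x set) \<alpha>. finite X \<and> lts A X \<alpha> \<and> productive X \<alpha> \<and>
        (\<exists>x\<in>X. \<exists>\<phi>. solution \<sigma> X \<alpha> \<phi> \<and> K = \<phi> x)"
      using X(1-4) sol by blast
  next
    assume "\<exists>(X :: 'x set) \<alpha>. finite X \<and> lts A X \<alpha> \<and> productive X \<alpha> \<and>
        (\<exists>x\<in>X. \<exists>\<phi>. solution \<sigma> X \<alpha> \<phi> \<and> K = \<phi> x)"
    then obtain X :: "'x set" and \<alpha> x \<phi> where X: "finite X" "lts A X \<alpha>" "productive X \<alpha>" "x \<in> X"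
        "solution \<sigma> X \<alpha> \<phi>" "K = \<phi> x"
      by blast
    obtain \<iota> :: "'x \<Rightarrow> nat" where "inj_on \<iota> X"
      using finite_imp_inj_to_nat_seg[OF X(1)] by blast
    then interpret finite_productive_lts A X \<alpha> \<iota>
      using assms(1) X(1-3) by unfold_locales
    obtain e where "e \<in> process_terms A" "\<And>s. emits \<alpha> x s \<longleftrightarrow> emits term_lts e s"
      using exists_process_term[OF X(4)] by blast
    then show "regular_subfractal A \<sigma> K"
      using solution_eq_state_sem[OF X(1,2,5,4)] X(6)
      unfolding regular_subfractal_def state_sem_def by auto
  qed
qed

end
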